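(* Let $D$ be an $n$-diagram ($n\ge 1$), and let the word $V$ on $l$ strands and the word $W$ on $m$ strands be two braidings of $D$ (i.e. the closures of $V$ and $W$ are both equal to $D$). Then $V$ and $W$ are related by a finite sequence of the following moves: (i) commutativity relations in $C_p$; (ii) cyclic permutation in $C_p$; (iii) stabilization (and its inverse). Here $p\ge 1$ is the number of strands of the word to which the move is applied.
   Context: An $n$-diagram (chord diagram) is an oriented circle with $2n$ distinct marked points partitioned into $n$ pairs (the chords), up to orientation-preserving homeomorphism. The chord algebra $C_m$ has generators $A(i,j)$, $1\le i<j\le m$, and relations $A(i,j)A(k,l)=A(k,l)A(i,j)$ for $i,j,k,l$ distinct (the commutativity relations). A word on $m$ strands is a word $W=A(i_1,j_1)\cdots A(i_n,j_n)$ in these generators (together with the number $m$), where $A(i,j)$ is viewed as a horizontal chord joining strands $i$ and $j$ of the identity $m$-braid, the letters being placed from top to bottom. The closure of $W$ is the $n$-diagram obtained by joining the bottom of strand $k$ to the top of strand $k+1$ ($k<m$) and the bottom of strand $m$ to the top of strand $1$; i.e. the cyclic sequence of chord labels around the circle is $L_1L_2\cdots L_m$, where $L_k$ is the increasing sequence of those $r$ with $k\in\{i_r,j_r\}$. If $D$ is the closure of $W$, then $W$ is called a braiding (braid representative) of $D$. Cyclic permutation in $C_m$: replace a word $W'A(i,j)$ with $j<m$ by $A(i+1,j+1)W'$, or replace $W'A(i,m)$ by $A(1,i+1)W'$; the inverses of these operations are also allowed. Stabilization: replace the word $UA(i,m)$ on $m$ strands by the word $UA(i,m+1)$ on $m+1$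 strands (here $U$ is any word on $m$ strands and $i<m$); the inverse operation is also called stabilization. *)

theory Defs
  imports "HOL-Analysis.Analysis"
begin

section \<open>Chord diagrams\<close>

text \<open>The circle is the unit circle of the complex plane with its counterclockwise orientation.
  A chord is identified with its pair of endpoints.\<close>

abbreviation circle :: "complex set" where
  "circle \<equiv> sphere 0 1"

definition chord_configs :: "nat \<Rightarrow> complex set set set" where
  "chord_configs n = {C. finite C \<and> card C = n \<and> pairwise disjnt C \<and>
     (\<forall>c\<in>C. c \<subseteq> circle \<and> card c = 2)}"

text \<open>A self-homeomorphism of the circle preserves the orientation iff it has a strictly
  increasing lift to the universal cover.\<close>

definition orient_homeo :: "(complex \<Rightarrow> complex) \<Rightarrow> bool" where
  "orient_homeo h \<longleftrightarrow> (\<exists>k. homeomorphism circle circle h k) \<and>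
     (\<exists>g :: real \<Rightarrow> real. continuous_on UNIV g \<and> strict_mono g \<and>
        (\<forall>t. g (t + 2 * pi) = g t + 2 * pi) \<and> (\<forall>t. h (cis t) = cis (g t)))"

definition config_rel :: "(complex set set \<times> complex set set) set" where
  "config_rel = {(C, C'). C \<in> (\<Union>n. chord_configs n) \<and>
     (\<exists>h. orient_homeo h \<and> C' = (\<lambda>c. h ` c) ` C)}"

definition chord_diagrams :: "nat \<Rightarrow> complex set set set set" where
  "chord_diagrams n = (\<lambda>C. config_rel `` {C}) ` chord_configs n"


section \<open>Words and their closures\<close>

text \<open>The generator \<open>A(i,j)\<close> is the pair \<open>(i, j)\<close>; a word carries its number of strands as
  first component.\<close>

type_synonym strand_word = "nat \<times> (nat \<times> nat) list"

definition is_word :: "nat \<Rightarrow> (nat \<times> nat) list \<Rightarrow> bool" where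
  "is_word m W \<longleftrightarrow> 1 \<le> m \<and> (\<forall>(i, j) \<in> set W. 1 \<le> i \<and> i < j \<and> j \<le> m)"

text \<open>Letters are numbered from \<open>0\<close>, top to bottom.\<close>

definition strand_labels :: "(nat \<times> nat) list \<Rightarrow> nat \<Rightarrow> nat list" where
  "strand_labels W k = filter (\<lambda>r. k \<in> {fst (W ! r), snd (W ! r)}) [0..<length W]"

definition label_seq :: "strand_word \<Rightarrow> nat list" where
  "label_seq = (\<lambda>(m, W). concat (map (strand_labels W) [1..<Suc m]))"

text \<open>The labels are placed counterclockwise at equidistant points of the circle, and two points
  are joined by a chord when they carry the same label.\<close>

definition closure_config :: "strand_word \<Rightarrow> complex set set" where
  "closure_config w = (let s = label_seq w; N = length s in
     (\<lambda>r. {cis (2 * pi * real p / real N) | p. p < N \<and> s ! p = r}) ` {..<length (snd w)})"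

definition word_closure :: "strand_word \<Rightarrow> complex set set set" where
  "word_closure w = config_rel `` {closure_config w}"

definition braiding :: "strand_word \<Rightarrow> complex set set set \<Rightarrow> bool" where
  "braiding w D \<longleftrightarrow> is_word (fst w) (snd w) \<and> word_closure w = D"


section \<open>Moves\<close>

text \<open>Inverse moves are supplied by taking the equivalence closure \<open>equivclp move\<close>.\<close>

inductive move :: "strand_word \<Rightarrow> strand_word \<Rightarrow> bool" where
  commutativity:
    "is_word p (U @ [(i, j), (k, l)] @ U') \<Longrightarrow> distinct [i, j, k, l] \<Longrightarrow>
       move (p, U @ [(i, j), (k, l)] @ U') (p, U @ [(k, l), (i, j)] @ U')"
| cyclic:
    "is_word p (W' @ [(i, j)]) \<Longrightarrow> j < p \<Longrightarrow>
       move (p, W' @ [(i, j)]) (p, (i + 1, j + 1) # W')"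
| cyclic_last:
    "is_word p (W' @ [(i, p)]) \<Longrightarrow>
       move (p, W' @ [(i, p)]) (p, (1, i + 1) # W')"
| stabilization:
    "is_word p (U @ [(i, p)]) \<Longrightarrow>
       move (p, U @ [(i, p)]) (p + 1, U @ [(i, p + 1)])"


section \<open>Well-definedness\<close>

lemma orient_homeo_id: "orient_homeo (\<lambda>z. z)"
  unfolding orient_homeo_def
  by (intro conjI exI[of _ "\<lambda>z. z"]) (auto simp: homeomorphism_ident strict_mono_def)

lemma orient_homeo_comp:
  assumes "orient_homeo h" "orient_homeo h'" shows "orient_homeo (\<lambda>z. h' (h z))"
proof -
  obtain k g k' g' where
   1: "homeomorphism circle circle h k" "homeomorphism circle circle h' k'"
   and 2: "continuous_on UNIV g" "strict_mono g" "\<forall>t. g (t + 2 * pi) = g t + 2 * pi" "\<forall>t. h (cis t) = cis (g t)"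
   and 3: "continuous_on UNIV g'" "strict_mono g'" "\<forall>t. g' (t + 2 * pi) = g' t + 2 * pi" "\<forall>t. h' (cis t) = cis (g' t)"
    using assms unfolding orient_homeo_def by blast
  have "homeomorphism circle circle (h' \<circ> h) (k \<circ> k')"
    by (rule homeomorphism_compose[OF 1])
  hence a: "homeomorphism circle circle (\<lambda>z. h' (h z)) (k \<circ> k')" by (simp add: o_def)
  have "continuous_on UNIV (\<lambda>t. g' (g t))"
    by (rule continuous_on_compose2[OF 3(1) 2(1)]) auto
  moreover have "strict_mono (\<lambda>t. g' (g t))" using 2(2) 3(2) by (auto simp: strict_mono_def)
  ultimately show ?thesis unfolding orient_homeo_def using a 2 3
    by (intro conjI exI[of _ "k \<circ> k'"] exI[of _ "\<lambda>t. g' (g t)"]) auto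
qed

lemma orient_homeo_inv:
  assumes "orient_homeo h"
  shows "\<exists>k. orient_homeo k \<and> (\<forall>z\<in>circle. k (h z) = z)"
proof -
  obtain k g where
   1: "homeomorphism circle circle h k"
   and 2: "continuous_on UNIV g" "strict_mono g" "\<And>t. g (t + 2 * pi) = g t + 2 * pi" "\<And>t. h (cis t) = cis (g t)"
    using assms unfolding orient_homeo_def by blast
  have n: "g (t + 2 * pi * real n) = g t + 2 * pi * real n" for t n
  proof (induction n)
    case (Suc n)
    have "g (t + 2 * pi * real (Suc n)) = g ((t + 2 * pi * real n) + 2*pi)" by (simp add: algebra_simps)
    also have "\<dots> = g t + 2 * pi * real n + 2 * pi" using 2(3)[of "t + 2 * pi * real n"] Suc by simp
    finally show ?case by (simp add: algebra_simps)
  qed simp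
  have inj: "inj g" using 2(2) by (rule strict_mono_imp_inj_on)
  have surj: "\<exists>x. g x = y" for y
  proof -
    obtain n where n1: "real n * (2*pi) > \<bar>y\<bar> + \<bar>g 0\<bar>"
      using reals_Archimedean3[of "2*pi"] by auto
    have a: "g (2*pi*real n) = g 0 + 2 * pi * real n" using n[of 0 n] by simp
    have b: "g (- (2*pi*real n)) = g 0 - 2 * pi * real n" using n[of "- (2*pi*real n)" n] by simp
    have "\<exists>x\<ge>- (2*pi*real n). x \<le> 2*pi*real n \<and> g x = y"
    proof (rule IVT')
      show "g (- (2 * pi * real n)) \<le> y" using b n1 by (simp add: mult.commute mult.left_commute)
      show "y \<le> g (2 * pi * real n)" using a n1 by (simp add: mult.commute mult.left_commute)
      show "- (2 * pi * real n) \<le> 2 * pi * real n" by simp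
      show "continuous_on {- (2 * pi * real n)..2 * pi * real n} g" using 2(1) continuous_on_subset by blast
    qed
    thus ?thesis by blast
  qed
  hence sg: "surj g" by (metis surjI surj_def)
  define f where "f = inv g"
  have gf: "g (f y) = y" for y unfolding f_def using sg by (simp add: surj_f_inv_f)
  have fg: "f (g y) = y" for y unfolding f_def using inj by simp
  have sf: "strict_mono f"
    by (rule strict_monoI) (metis 2(2) gf strict_mono_less)
  have cf: "continuous_on UNIV f"
  proof -
    have "surj f" using fg by (rule surjI)
    thus ?thesis using sf by (intro continuous_onI_mono) (auto simp: strict_mono_less_eq)
  qed
  have per: "f (t + 2*pi) = f t + 2*pi" for t by (metis 2(3) fg gf)
  have k: "k (cis t) = cis (f t)" for t
  proof -
    have "cis (f t) \<in> circle" by simp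
    hence "k (h (cis (f t))) = cis (f t)" using 1 unfolding homeomorphism_def by blast
    thus ?thesis using 2(4) gf by simp
  qed
  have "orient_homeo k" unfolding orient_homeo_def
    using homeomorphism_symD[OF 1] cf sf per k by blast
  thus ?thesis using 1 unfolding homeomorphism_def by blast
qed

lemma orient_homeo_config:
  assumes "orient_homeo h" "C \<in> chord_configs n" shows "(\<lambda>c. h ` c) ` C \<in> chord_configs n"
proof -
  obtain k where k: "homeomorphism circle circle h k" using assms unfolding orient_homeo_def by blast
  have inj: "inj_on h circle" using k unfolding homeomorphism_def by (metis inj_on_inverseI)
  have C: "finite C" "card C = n" "pairwise disjnt C" "\<And>c. c \<in> C \<Longrightarrow> c \<subseteq> circle \<and> card c = 2"
    using assms(2) unfolding chord_configs_def by auto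
  have i2: "inj_on (\<lambda>c. h ` c) C" using inj C(4) by (meson inj_onI inj_on_image_eq_iff)
  have d: "disjnt (h ` c) (h ` c')" if "c \<in> C" "c' \<in> C" "c \<noteq> c'" for c c'
  proof -
    have "c \<inter> c' = {}" using C(3) that unfolding pairwise_def disjnt_def by blast
    moreover have "h ` (c \<inter> c') = h ` c \<inter> h ` c'"
      by (rule inj_on_image_Int[OF inj]) (use C(4) that in auto)
    ultimately show ?thesis by (simp add: disjnt_def)
  qed
  have "card (h ` c) = 2" "h ` c \<subseteq> circle" if "c \<in> C" for c
  proof -
    show "card (h ` c) = 2" using that C(4) inj by (metis card_image inj_on_subset)
    have "h ` circle = circle" using k unfolding homeomorphism_def by blast
    thus "h ` c \<subseteq> circle" using that C(4) by blast
  qed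
  moreover have "pairwise disjnt ((\<lambda>c. h ` c) ` C)"
    unfolding pairwise_def using d by blast
  ultimately show ?thesis unfolding chord_configs_def using C i2
    by (auto simp: card_image)
qed

lemma equiv_config_rel: "equiv (\<Union>n. chord_configs n) config_rel"
proof (rule equivI)
  show "refl_on (\<Union>n. chord_configs n) config_rel"
    using orient_homeo_id orient_homeo_config unfolding refl_on_def config_rel_def by fastforce
  show "config_rel \<subseteq> (\<Union>n. chord_configs n) \<times> (\<Union>n. chord_configs n)"
    using orient_homeo_config unfolding config_rel_def by fastforce
  show "sym config_rel"
  proof (rule symI)
    fix C C' assume "(C, C') \<in> config_rel"
    then obtain h n where h: "orient_homeo h" "C \<in> chord_configs n" "C' = (\<lambda>c. h ` c) ` C"
      unfolding config_rel_def by blast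
    obtain k where k: "orient_homeo k" "\<And>z. z \<in> circle \<Longrightarrow> k (h z) = z" using orient_homeo_inv[OF h(1)] by blast
    have "k ` h ` c = c" if "c \<in> C" for c
    proof -
      have "c \<subseteq> circle" using h(2) that unfolding chord_configs_def by blast
      thus ?thesis using k(2) by (force simp: image_image)
    qed
    hence "(\<lambda>c. k ` c) ` C' = C" unfolding h(3) image_image by simp
    moreover have "C' \<in> chord_configs n" using orient_homeo_config h by blast
    ultimately show "(C', C) \<in> config_rel" unfolding config_rel_def using k(1) by blast
  qed
  show "trans config_rel"
  proof (rule transI)
    fix C C' C'' assume "(C, C') \<in> config_rel" "(C', C'') \<in> config_rel"
    then obtain h h' where h: "orient_homeo h" "C \<in> (\<Union>n. chord_configs n)" "C' = (\<lambda>c. h ` c) ` C"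
       "orient_homeo h'" "C'' = (\<lambda>c. h' ` c) ` C'"
      unfolding config_rel_def by blast
    have "C'' = (\<lambda>c. (\<lambda>z. h' (h z)) ` c) ` C" unfolding h by (simp add: image_image)
    thus "(C, C'') \<in> config_rel" unfolding config_rel_def using orient_homeo_comp[OF h(1,4)] h(2) by blast
  qed
qed

lemma count_label_seq:
  assumes "is_word m W" "r < length W"
  shows "card {p. p < length (label_seq (m, W)) \<and> label_seq (m, W) ! p = r} = 2"
proof -
  let ?s = "label_seq (m, W)"
  obtain i j where ij: "W ! r = (i, j)" by fastforce
  have b: "1 \<le> i" "i < j" "j \<le> m" using assms ij nth_mem[OF assms(2)] unfolding is_word_def by auto
  have "length (filter ((=) r) (strand_labels W k)) = (if k = i \<or> k = j then 1 else 0)" for k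
  proof -
    have "filter ((=) r) (strand_labels W k) = (if k = i \<or> k = j then [r] else [])"
    proof -
      have d: "distinct (strand_labels W k)" unfolding strand_labels_def by simp
      have e: "r \<in> set (strand_labels W k) \<longleftrightarrow> k = i \<or> k = j"
        unfolding strand_labels_def using ij assms(2) by auto
      have "distinct xs \<Longrightarrow> filter ((=) r) xs = (if r \<in> set xs then [r] else [])" for xs :: "nat list"
        by (induction xs) auto
      thus ?thesis using d e by simp
    qed
    thus ?thesis by simp
  qed
  hence "length (filter ((=) r) ?s) = sum_list (map (\<lambda>k. if k = i \<or> k = j then 1 else 0) [1..<Suc m])"
    unfolding label_seq_def by (simp add: filter_concat length_concat o_def del: upt_Suc)
  also have "\<dots> = (\<Sum>k\<in>{1..<Suc m}. if k = i \<or> k = j then 1 else 0)"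
    by (simp only: interv_sum_list_conv_sum_set_nat set_upt)
  also have "\<dots> = card ({1..<Suc m} \<inter> {k. k = i \<or> k = j})" by (simp add: sum.If_cases del: sum.op_ivl_Suc)
  also have "{1..<Suc m} \<inter> {k. k = i \<or> k = j} = {i, j}" using b by auto
  also have "card {i, j} = 2" using b by simp
  finally have "card {p. p < length ?s \<and> r = ?s ! p} = 2"
    by (simp only: length_filter_conv_card)
  moreover have "{p. p < length ?s \<and> r = ?s ! p} = {p. p < length ?s \<and> ?s ! p = r}"
    by blast
  ultimately show ?thesis by simp
qed

lemma closure_config_in:
  assumes "is_word m W"
  shows "closure_config (m, W) \<in> chord_configs (length W)"
proof -
  define s where "s = label_seq (m, W)"
  define N where "N = length s"
  define P where "P r = {p. p < N \<and> s ! p = r}" for r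
  define f where "f p = cis (2 * pi * real p / real N)" for p
  have inj: "inj_on f {..<N}"
  proof (rule inj_onI)
    fix p q assume pq: "p \<in> {..<N}" "q \<in> {..<N}" "f p = f q"
    have "N > 0" using pq(1) by auto
    note roots = Complex.bij_betw_roots_unity[OF this]
    show "p = q" using pq roots unfolding f_def bij_betw_def inj_on_def by blast
  qed
  have c: "card (P r) = 2" if "r < length W" for r
    using count_label_seq[OF assms that] unfolding P_def N_def s_def .
  have sub: "P r \<subseteq> {..<N}" for r unfolding P_def by auto
  have eq: "closure_config (m, W) = (\<lambda>r. f ` P r) ` {..<length W}"
    unfolding closure_config_def Let_def P_def f_def N_def s_def by (auto simp: image_def)
  have dis: "f ` P r \<inter> f ` P r' = {}" if "r \<noteq> r'" for r r'
  proof -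
    have "P r \<inter> P r' = {}" using that unfolding P_def by auto
    thus ?thesis using inj_on_image_Int[OF inj sub sub, of r r'] by simp
  qed
  have card2: "card (f ` P r) = 2" if "r < length W" for r
    using c[OF that] inj sub by (metis card_image inj_on_subset)
  have ij: "inj_on (\<lambda>r. f ` P r) {..<length W}"
  proof (rule inj_onI)
    fix r r' assume a: "r \<in> {..<length W}" "f ` P r = f ` P r'"
    show "r = r'" using dis[of r r'] card2[of r] a by fastforce
  qed
  have "pairwise disjnt ((\<lambda>r. f ` P r) ` {..<length W})"
  proof (rule pairwiseI)
    fix c c' assume "c \<in> (\<lambda>r. f ` P r) ` {..<length W}" "c' \<in> (\<lambda>r. f ` P r) ` {..<length W}" "c \<noteq> c'"
    then obtain r r' where "c = f ` P r" "c' = f ` P r'" "r \<noteq> r'" by fast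
    then show "disjnt c c'" using dis unfolding disjnt_def by simp
  qed
  moreover have "finite ((\<lambda>r. f ` P r) ` {..<length W})"
    by simp
  moreover have "card ((\<lambda>r. f ` P r) ` {..<length W}) = length W"
    using card_image[OF ij] by simp
  moreover have "f ` P r \<subseteq> circle" for r
    by (rule image_subsetI) (simp add: f_def)
  then have "\<forall>c\<in>(\<lambda>r. f ` P r) ` {..<length W}. c \<subseteq> circle \<and> card c = 2"
    using card2 by fast
  ultimately show ?thesis unfolding eq chord_configs_def mem_Collect_eq
    by (intro conjI)
qed

lemma word_closure_in: "is_word m W \<Longrightarrow> word_closure (m, W) \<in> chord_diagrams (length W)"
  unfolding word_closure_def chord_diagrams_def by (intro imageI closure_config_in)

end

theory Submission
  imports Defs
begin

text \<open>Conjugating stabilization by cyclic permutations shows that any strand \<open>j\<close> may be cut just above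
  any letter touching it: the part of the strand below the cut becomes a new strand \<open>j + 1\<close>. Cutting
  does not change the sequence of labels around the circle. By cutting strands, and by undoing cuts
  in order to remove empty strands, every word becomes one in which each strand carries
  exactly one endpoint. All letters of such a word commute, so it is determined up to commutativity
  by its diagram with a base point, and shifting the base point amounts to cyclically permuting
  all letters once.\<close>

section \<open>Cutting a strand\<close>

abbreviation meq :: "strand_word \<Rightarrow> strand_word \<Rightarrow> bool" (infix "\<simeq>" 50) where
  "meq \<equiv> equivclp move"

lemma meq_sym: "v \<simeq> w \<Longrightarrow> w \<simeq> v"
  by (rule equivclp_sym)

lemma meq_trans [trans]: "u \<simeq> v \<Longrightarrow> v \<simeq> w \<Longrightarrow> u \<simeq> w"
  by (rule equivclp_trans)

lemma meq_move: "move v w \<Longrightarrow> v \<simeq> w"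
  by (rule r_into_equivclp)

abbreviation ends :: "nat \<times> nat \<Rightarrow> nat set" where
  "ends x \<equiv> {fst x, snd x}"

lemma is_word_iff: "is_word m W \<longleftrightarrow> 1 \<le> m \<and> (\<forall>x\<in>set W. 1 \<le> fst x \<and> fst x < snd x \<and> snd x \<le> m)"
  by (auto simp: is_word_def)

lemma is_word_append: "is_word m (U @ V) \<longleftrightarrow> is_word m U \<and> is_word m V"
  by (auto simp: is_word_iff)

section \<open>Occupied strands and their renumbering\<close>

abbreviation strands :: "(nat \<times> nat) list \<Rightarrow> nat set" where
  "strands W \<equiv> (\<Union>x\<in>set W. ends x)"

lemma strands_subset: "is_word m W \<Longrightarrow> strands W \<subseteq> {1..m}"
  by (force simp: is_word_iff)

text \<open>A renumbering such as the cyclic shift can reverse the order of the two ends of a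
  letter; \<open>min\<close> and \<open>max\<close> restore the convention that the smaller strand
  comes first.\<close>

definition relabel :: "(nat \<Rightarrow> nat) \<Rightarrow> nat \<times> nat \<Rightarrow> nat \<times> nat" where
  "relabel f x = (min (f (fst x)) (f (snd x)), max (f (fst x)) (f (snd x)))"

lemma ends_relabel [simp]: "ends (relabel f x) = f ` ends x"
  by (auto simp: relabel_def min_def max_def)

lemma relabel_relabel: "relabel f (relabel g x) = relabel (\<lambda>a. f (g a)) x"
  by (auto simp: relabel_def min_def max_def)

lemma relabel_cong: "(\<And>a. a \<in> ends x \<Longrightarrow> f a = g a) \<Longrightarrow> relabel f x = relabel g x"
  by (auto simp: relabel_def)

lemma relabel_ident: "fst x < snd x \<Longrightarrow> (\<And>a. a \<in> ends x \<Longrightarrow> f a = a) \<Longrightarrow> relabel f x = x"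
  by (auto simp: relabel_def)

text \<open>Injectivity keeps the two ends of a letter apart. It is asked only on a set
  \<open>S\<close> containing the occupied strands, because closing up an empty strand is not
  injective on \<open>{1..m}\<close>.\<close>

lemma is_word_relabel:
  assumes "is_word m W" "strands W \<subseteq> S" "inj_on f S" "f ` S \<subseteq> {1..m'}" "1 \<le> m'"
  shows "is_word m' (map (relabel f) W)"
  unfolding is_word_iff
proof (intro conjI ballI)
  fix y assume "y \<in> set (map (relabel f) W)"
  then obtain x where x: "x \<in> set W" "y = relabel f x" by auto
  have x1: "fst x < snd x" using assms(1) x(1) by (auto simp: is_word_iff)
  have m: "fst x \<in> S" "snd x \<in> S" using assms(2) x(1) by auto
  have "f (fst x) \<noteq> f (snd x)" using inj_onD[OF assms(3) _ m] x1 by auto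
  moreover have "f (fst x) \<in> {1..m'}" "f (snd x) \<in> {1..m'}" using m assms(4) by blast+
  ultimately show "1 \<le> fst y" "fst y < snd y" "snd y \<le> m'"
    using x(2) by (auto simp: relabel_def)
qed (rule assms)

section \<open>Cyclic permutation of blocks of letters\<close>

definition next_strand :: "nat \<Rightarrow> nat \<Rightarrow> nat" where
  "next_strand m a = (if a = m then 1 else a + 1)"

lemma is_word_next: "is_word m W \<Longrightarrow> is_word m (map (relabel (next_strand m)) W)"
  by (rule is_word_relabel[where S = "{1..m}"], assumption, erule strands_subset)
     (auto simp: is_word_def inj_on_def next_strand_def split: if_splits)

text \<open>Thanks to the sorting in \<open>relabel\<close>, both cyclic moves are the same
  operation: an end on strand \<open>p\<close> wraps round to 1 and becomes the smaller one.\<close>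

lemma cyclic_step:
  assumes "is_word p (W @ [x])"
  shows "(p, W @ [x]) \<simeq> (p, relabel (next_strand p) x # W)"
proof -
  obtain i j where x: "x = (i, j)" by fastforce
  have ij: "1 \<le> i" "i < j" "j \<le> p" using assms x by (auto simp: is_word_iff)
  show ?thesis
  proof (cases "j = p")
    case True
    then have "relabel (next_strand p) x = (1, i + 1)"
      using ij x by (auto simp: relabel_def next_strand_def)
    then show ?thesis using meq_move[OF cyclic_last] assms x True by metis
  next
    case False
    then have "relabel (next_strand p) x = (i + 1, j + 1)"
      using ij x by (auto simp: relabel_def next_strand_def)
    moreover have "j < p" using False ij by simp
    ultimately show ?thesis using meq_move[OF cyclic] assms x by metis
  qed
qed

text \<open>The letters of \<open>X\<close> travel to the top one at a time, the last one first, so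
  they keep their order. \<open>W\<close> is generalized because letters already moved are stacked
  on it.\<close>

lemma cyclic_steps:
  "is_word p (W @ X) \<Longrightarrow> (p, W @ X) \<simeq> (p, map (relabel (next_strand p)) X @ W)"
proof (induction X arbitrary: W rule: rev_induct)
  case (snoc x X)
  let ?x = "relabel (next_strand p) x"
  have w: "is_word p ((W @ X) @ [x])" using snoc.prems by simp
  have "is_word p [?x]" using is_word_next[of p "[x]"] w by (simp add: is_word_append)
  then have w': "is_word p ((?x # W) @ X)" using w unfolding is_word_iff by simp
  have "(p, W @ X @ [x]) \<simeq> (p, ?x # W @ X)" using cyclic_step[OF w] by (simp only: append_assoc)
  also have "\<dots> \<simeq> (p, map (relabel (next_strand p)) X @ ?x # W)"
    using snoc.IH[OF w'] by (simp only: append_Cons)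
  finally show ?case by (simp only: map_append list.map append_assoc append_Cons append_Nil)
next
  case Nil
  show ?case by (simp only: list.map append_Nil2 append_Nil equivclp_refl)
qed

text \<open>With \<open>W\<close> empty, all letters travel round once. This carries a
  stabilization, available only at the last strand, to any other strand.\<close>

lemma rotate_strands: "is_word p X \<Longrightarrow> (p, X) \<simeq> (p, map (relabel (next_strand p)) X)"
  using cyclic_steps[of p "[]" X] by (simp only: append_Nil append_Nil2)

text \<open>The cut turns the part of strand \<open>j\<close> below it into strand \<open>j + 1\<close>; the two functions renumber
  the strands above and below the height of the cut.\<close>

definition below_cut :: "nat \<Rightarrow> nat \<Rightarrow> nat" where
  "below_cut j a = (if a < j then a else a + 1)"

definition above_cut :: "nat \<Rightarrow> nat \<Rightarrow> nat" where
  "above_cut j a = (if a \<le> j then a else a + 1)"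

definition cut_strand :: "nat \<Rightarrow> nat \<Rightarrow> (nat \<times> nat) list \<Rightarrow> (nat \<times> nat) list" where
  "cut_strand j r W = map (relabel (above_cut j)) (take r W) @ map (relabel (below_cut j)) (drop r W)"

lemma is_word_below: "is_word m W \<Longrightarrow> is_word (m + 1) (map (relabel (below_cut j)) W)"
  by (rule is_word_relabel[where S = "{1..m}"], assumption, erule strands_subset)
     (auto simp: is_word_def inj_on_def below_cut_def split: if_splits)

lemma is_word_above: "is_word m W \<Longrightarrow> is_word (m + 1) (map (relabel (above_cut j)) W)"
  by (rule is_word_relabel[where S = "{1..m}"], assumption, erule strands_subset)
     (auto simp: is_word_def inj_on_def above_cut_def split: if_splits)

lemma is_word_take_drop: "is_word m W \<Longrightarrow> is_word m (take r W)" "is_word m W \<Longrightarrow> is_word m (drop r W)"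
  by (auto simp: is_word_iff dest: in_set_takeD in_set_dropD)

lemma is_word_cut: "is_word m W \<Longrightarrow> is_word (m + 1) (cut_strand j r W)"
  unfolding cut_strand_def is_word_append
  using is_word_below is_word_above is_word_take_drop by blast

text \<open>For \<open>j = m\<close> this is a stabilization. Otherwise rotate the strands once, cut
  strand \<open>j + 1\<close>, and rotate back on \<open>m + 1\<close> strands; the induction thus
  runs from \<open>m\<close> downwards.\<close>

lemma cut_last:
  assumes "is_word m (U @ [x])" "j \<in> ends x"
  shows "(m, U @ [x]) \<simeq> (m + 1, map (relabel (above_cut j)) U @ [relabel (below_cut j) x])"
proof -
  have "j \<le> m" using assms by (auto simp: is_word_iff)
  then show ?thesis using assms
  proof (induction j arbitrary: U x rule: inc_induct)
    case base
    obtain i where x: "x = (i, m)" and i: "i < m"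
      using base by (cases x) (auto simp: is_word_iff)
    have "map (relabel (above_cut m)) U = U"
      using base(1) by (intro map_idI relabel_ident) (auto simp: is_word_iff above_cut_def)
    moreover have "relabel (below_cut m) x = (i, m + 1)"
      using x i by (simp add: relabel_def below_cut_def)
    ultimately show ?case using meq_move[OF stabilization, of m U i] base(1) x by simp
  next
    case (step j)
    let ?n = "relabel (next_strand m)" and ?n' = "relabel (next_strand (m + 1))"
    let ?U = "map (relabel (above_cut j)) U" and ?x = "relabel (below_cut j) x"
    \<comment> \<open>Rotation takes strand \<open>m\<close> to strand 1, which has to lie to the
      left of the cut at \<open>Suc j\<close> in order to be fixed by
      \<open>below_cut\<close>.\<close>
    have "1 \<le> j" using step.prems by (auto simp: is_word_iff)
    have w': "is_word (m + 1) (?U @ [?x])"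
      using step.prems(1) is_word_above[of m U] is_word_below[of m "[x]"] by (simp add: is_word_append)
    have "(m, U @ [x]) \<simeq> (m, map ?n U @ [?n x])"
      using rotate_strands[OF step.prems(1)] by simp
    also have "\<dots> \<simeq> (m + 1, map (relabel (above_cut (Suc j))) (map ?n U)
        @ [relabel (below_cut (Suc j)) (?n x)])"
    proof (rule step.IH)
      show "is_word m (map ?n U @ [?n x])" using is_word_next[OF step.prems(1)] by simp
      show "Suc j \<in> ends (?n x)"
        unfolding ends_relabel using step.prems(2) step.hyps by (auto simp: next_strand_def)
    qed
    also have "map (relabel (above_cut (Suc j))) (map ?n U) = map ?n' ?U"
      using step by (auto simp: relabel_relabel is_word_iff above_cut_def next_strand_def intro!: relabel_cong)
    also have "relabel (below_cut (Suc j)) (?n x) = ?n' ?x"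
      unfolding relabel_relabel
    proof (rule relabel_cong)
      fix a assume "a \<in> ends x"
      then have "1 \<le> a" "a \<le> m" using step.prems(1) by (auto simp: is_word_iff)
      then show "below_cut (Suc j) (next_strand m a) = next_strand (m + 1) (below_cut j a)"
        using step.hyps \<open>1 \<le> j\<close> by (auto simp: below_cut_def next_strand_def)
    qed
    also have "(m + 1, map ?n' ?U @ [?n' ?x]) \<simeq> (m + 1, ?U @ [?x])"
      using meq_sym[OF rotate_strands[OF w']] by simp
    finally show ?case .
  qed
qed

text \<open>The letters below \<open>x\<close> are sent round to the top so that \<open>x\<close>
  becomes last; after the cut they return to the bottom.\<close>

lemma cut_append:
  assumes "is_word m (U @ x # Z)" "j \<in> ends x"
  shows "(m, U @ x # Z) \<simeq> (m + 1, map (relabel (above_cut j)) U @ map (relabel (below_cut j)) (x # Z))"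
proof -
  let ?n = "relabel (next_strand m)" and ?n' = "relabel (next_strand (m + 1))"
  let ?a = "relabel (above_cut j)" and ?b = "relabel (below_cut j)"
  have j: "1 \<le> j" "j \<le> m" using assms by (auto simp: is_word_iff)
  have w: "is_word m U" "is_word m [x]" "is_word m Z"
    using assms(1) by (auto simp: is_word_iff)
  have w': "is_word (m + 1) ((map ?a U @ [?b x]) @ map ?b Z)"
    using is_word_above[OF w(1), of j] is_word_below[OF w(2), of j] is_word_below[OF w(3), of j]
    by (auto simp: is_word_def)
  have "(m, U @ x # Z) \<simeq> (m, map ?n Z @ U @ [x])"
    using cyclic_steps[of m "U @ [x]" Z] assms(1) by simp
  also have "\<dots> \<simeq> (m + 1, map ?a (map ?n Z) @ map ?a U @ [?b x])"
    using cut_last[of m "map ?n Z @ U" x j] assms(2) w is_word_next[of m Z]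
    by (simp add: is_word_append)
  \<comment> \<open>At the top the letters of \<open>Z\<close> sit one strand further, so an end on
    \<open>j\<close> now lies beyond the cut strand (on strand 1 if \<open>j = m\<close>). Undoing
    the rotation therefore yields \<open>below_cut\<close>.\<close>
  also have "map ?a (map ?n Z) = map ?n' (map ?b Z)"
    unfolding map_map
  proof (rule map_cong, rule refl, unfold o_def relabel_relabel, rule relabel_cong)
    fix z a assume "z \<in> set Z" "a \<in> ends z"
    then have "1 \<le> a" "a \<le> m" using w(3) by (auto simp: is_word_iff)
    then show "above_cut j (next_strand m a) = next_strand (m + 1) (below_cut j a)"
      using j by (auto simp: below_cut_def above_cut_def next_strand_def)
  qed
  also have "(m + 1, map ?n' (map ?b Z) @ map ?a U @ [?b x]) \<simeq> (m + 1, map ?a U @ map ?b (x # Z))"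
    using meq_sym[OF cyclic_steps[OF w']] by simp
  finally show ?thesis .
qed

lemma meq_cut:
  assumes "is_word m W" "r < length W" "j \<in> ends (W ! r)"
  shows "(m, W) \<simeq> (m + 1, cut_strand j r W)"
proof -
  have W: "W = take r W @ W ! r # drop (Suc r) W" using assms(2) by (rule id_take_nth_drop)
  have "drop r W = W ! r # drop (Suc r) W" using assms(2) by (simp add: Cons_nth_drop_Suc)
  then show ?thesis using cut_append[of m "take r W" "W ! r" "drop (Suc r) W" j] assms W
    unfolding cut_strand_def by metis
qed

section \<open>Label sequence of a cut word\<close>

lemma length_cut [simp]: "length (cut_strand j r W) = length W"
  by (simp add: cut_strand_def)

lemma nth_cut:
  "q < length W \<Longrightarrow> cut_strand j r W ! q = relabel (if q < r then above_cut j else below_cut j) (W ! q)"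
  by (auto simp: cut_strand_def nth_append min_def)

lemma ends_cut:
  "q < length W \<Longrightarrow> k \<in> ends (cut_strand j r W ! q) \<longleftrightarrow>
    (if k < j then k \<in> ends (W ! q) else if k = j then q < r \<and> j \<in> ends (W ! q)
     else if k = j + 1 then r \<le> q \<and> j \<in> ends (W ! q) else k - 1 \<in> ends (W ! q))"
  unfolding nth_cut ends_relabel by (auto simp: above_cut_def below_cut_def)

lemma strand_labels_cut:
  "strand_labels (cut_strand j r W) k =
    (if k < j then strand_labels W k else if k = j then filter (\<lambda>q. q < r) (strand_labels W j)
     else if k = j + 1 then filter (\<lambda>q. r \<le> q) (strand_labels W j) else strand_labels W (k - 1))"
proof -
  have "strand_labels (cut_strand j r W) k = filter (\<lambda>q. (if k < j then k \<in> ends (W ! q) else if k = j then q < r \<and> j \<in> ends (W ! q)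
     else if k = j + 1 then r \<le> q \<and> j \<in> ends (W ! q) else k - 1 \<in> ends (W ! q))) [0..<length W]"
    unfolding strand_labels_def length_cut by (rule filter_cong) (simp_all only: ends_cut set_upt atLeastLessThan_iff)
  then show ?thesis unfolding strand_labels_def by (auto simp: conj_commute intro!: filter_cong)
qed

lemma filter_less_append:
  "sorted xs \<Longrightarrow> filter (\<lambda>q. q < r) xs @ filter (\<lambda>q. r \<le> q) xs = (xs :: nat list)"
proof (induction xs)
  case (Cons a xs)
  have "filter (\<lambda>q. q < r) xs = []" if "r \<le> a"
    using Cons.prems that by (force simp: filter_empty_conv)
  then show ?case using Cons by auto
qed simp

text \<open>The two halves of strand \<open>j\<close> are consecutive on the circle, and the labels
  along a strand increase, so the halves join up to the old list.\<close>

lemma label_seq_cut: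
  assumes "1 \<le> j" "j \<le> m"
  shows "label_seq (m + 1, cut_strand j r W) = label_seq (m, W)"
proof -
  have u: "[1..<Suc m] = [1..<j] @ [j] @ [j+1..<Suc m]"
    using assms upt_add_eq_append[of 1 j "Suc m - j"] by (simp add: upt_conv_Cons del: upt_Suc)
  have "[1..<Suc (m + 1)] = [1..<j] @ [j] @ [j+1] @ [j+2..<Suc (m+1)]"
    using assms upt_add_eq_append[of 1 j "Suc (m+1) - j"]
    by (simp add: upt_conv_Cons del: upt_Suc)
  moreover have "[j+2..<Suc (m+1)] = map Suc [j+1..<Suc m]" by (simp add: map_Suc_upt del: upt_Suc)
  ultimately have v: "[1..<Suc (m + 1)] = [1..<j] @ [j] @ [j+1] @ map Suc [j+1..<Suc m]" by simp
  have s: "sorted (strand_labels W j)" unfolding strand_labels_def by (intro sorted_filter[of id, simplified]) simp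
  have 1: "map (strand_labels (cut_strand j r W)) [1..<j] = map (strand_labels W) [1..<j]"
    by (auto simp: strand_labels_cut)
  have 2: "map (strand_labels (cut_strand j r W)) (map Suc [j+1..<Suc m]) = map (strand_labels W) [j+1..<Suc m]"
    by (auto simp: strand_labels_cut simp del: upt_Suc)
  have "label_seq (m + 1, cut_strand j r W) = concat (map (strand_labels W) [1..<j])
     @ (filter (\<lambda>q. q < r) (strand_labels W j) @ filter (\<lambda>q. r \<le> q) (strand_labels W j))
     @ concat (map (strand_labels W) [j+1..<Suc m])"
    unfolding label_seq_def prod.case v map_append 1 2 by (simp add: strand_labels_cut del: upt_Suc)
  also have "\<dots> = label_seq (m, W)"
    unfolding filter_less_append[OF s] label_seq_def prod.case u by simp
  finally show ?thesis .
qed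


section \<open>One endpoint on each strand\<close>

lemma mem_strands: "k \<in> strands W \<longleftrightarrow> (\<exists>r<length W. k \<in> ends (W ! r))"
  by (metis (no_types, lifting) UN_iff in_set_conv_nth)

lemma strand_labels_empty: "strand_labels W k = [] \<longleftrightarrow> k \<notin> strands W"
  unfolding mem_strands by (auto simp: strand_labels_def filter_empty_conv)

lemma set_strand_labels: "r \<in> set (strand_labels W k) \<longleftrightarrow> r < length W \<and> k \<in> ends (W ! r)"
  by (auto simp: strand_labels_def)

text \<open>A cut just above the topmost letter of a strand leaves an empty upper half, so an empty
  strand can be seen as the result of such a cut.\<close>

lemma first_letter_on_strand:
  assumes "k \<in> strands W"
  shows "\<exists>r<length W. k \<in> ends (W ! r) \<and> (\<forall>q<r. k \<notin> ends (W ! q))"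
proof -
  define P where "P r \<longleftrightarrow> r < length W \<and> k \<in> ends (W ! r)" for r
  have "\<exists>r. P r" using assms unfolding mem_strands P_def .
  then obtain r where r: "P r" "\<forall>q<r. \<not> P q" unfolding exists_least_iff[of P] by (elim exE conjE)
  have "r < length W" "k \<in> ends (W ! r)" using r(1) unfolding P_def by auto
  moreover have "\<forall>q<r. k \<notin> ends (W ! q)"
    using r(2) \<open>r < length W\<close> unfolding P_def by (meson less_trans)
  ultimately show ?thesis by (intro exI[of _ r] conjI)
qed

text \<open>The empty strand \<open>f - 1\<close> is the upper half, and \<open>f\<close> the lower
  half, of a strand cut just above its first letter. So \<open>W\<close> is a cut of the word in
  which \<open>g\<close> has closed the gap, and that cut is undone.\<close>

lemma drop_empty_strand:
  assumes W: "is_word m W" and f: "2 \<le> f" "f \<in> strands W" "f - 1 \<notin> strands W"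
  obtains W' where "is_word (m - 1) W'" "W' \<noteq> []" "(m, W) \<simeq> (m - 1, W')"
    "label_seq (m - 1, W') = label_seq (m, W)"
proof -
  define g where "g a = (if a < f then a else a - 1)" for a
  define W' where "W' = map (relabel g) W"
  have fm: "f \<le> m" using strands_subset[OF W] f(2) by auto
  have W': "is_word (m - 1) W'" unfolding W'_def
  proof (rule is_word_relabel[OF W])
    show "strands W \<subseteq> {1..m} - {f - 1}" using strands_subset[OF W] f(3) by blast
    show "inj_on g ({1..m} - {f - 1})" by (auto simp: inj_on_def g_def split: if_splits)
    show "g ` ({1..m} - {f - 1}) \<subseteq> {1..m - 1}" using f(1) fm by (auto simp: g_def)
  qed (use f(1) fm in simp)
  obtain r where r: "r < length W" "f \<in> ends (W ! r)" "\<forall>q<r. f \<notin> ends (W ! q)"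
    using first_letter_on_strand[OF f(2)] by (elim exE conjE)
  have cut: "cut_strand (f - 1) r W' = W"
  proof (rule nth_equalityI)
    fix q assume "q < length (cut_strand (f - 1) r W')"
    then have q: "q < length W" by (simp add: W'_def)
    then have "fst (W ! q) < snd (W ! q)" using W by (auto simp: is_word_iff)
    \<comment> \<open>No end is on \<open>f - 1\<close>, and above letter \<open>r\<close> none is
      on \<open>f\<close>; on the remaining ends the cut inverts \<open>g\<close>.\<close>
    moreover have "(if q < r then above_cut (f - 1) else below_cut (f - 1)) (g a) = a"
      if a: "a \<in> ends (W ! q)" for a
    proof -
      have "a \<in> strands W" using a q mem_strands by blast
      then have "a \<noteq> f - 1" using f(3) by blast
      moreover have "q < r \<longrightarrow> a \<noteq> f" using r(3) a by metis
      ultimately show ?thesis using f(1) by (auto simp: above_cut_def below_cut_def g_def)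
    qed
    ultimately have "relabel (if q < r then above_cut (f - 1) else below_cut (f - 1)) (relabel g (W ! q)) = W ! q"
      unfolding relabel_relabel by (rule relabel_ident)
    then show "cut_strand (f - 1) r W' ! q = W ! q"
      using q nth_cut[of q W' "f - 1" r] by (simp add: W'_def)
  qed (simp add: W'_def)
  have "f - 1 = g f" by (simp add: g_def)
  then have "f - 1 \<in> ends (W' ! r)" using r(1,2) by (simp only: W'_def nth_map ends_relabel) blast
  from meq_cut[OF W' _ this] have "(m - 1, W') \<simeq> (m, W)"
    using r(1) f(1) fm cut by (simp add: W'_def)
  moreover have "label_seq (m, W) = label_seq (m - 1, W')"
    using label_seq_cut[of "f - 1" "m - 1" r W'] f(1) fm cut by simp
  moreover have "W' \<noteq> []" using r(1) by (auto simp: W'_def)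
  ultimately show ?thesis using that W' meq_sym by metis
qed

text \<open>Rotating the strands once moves an empty last strand to the first position, where it is the
  result of cutting the following strand at its top.\<close>

lemma drop_last_strand:
  assumes W: "is_word m W" and "m \<notin> strands W" "1 \<in> strands W"
  shows "is_word (m - 1) W" "(m, W) \<simeq> (m - 1, W)" "label_seq (m - 1, W) = label_seq (m, W)"
proof -
  obtain r where r: "r < length W" "1 \<in> ends (W ! r)" "\<forall>q<r. 1 \<notin> ends (W ! q)"
    using first_letter_on_strand[OF assms(3)] by (elim exE conjE)
  have m: "1 \<le> m" "m \<noteq> 1" using assms by (auto simp: is_word_iff)
  show W': "is_word (m - 1) W"
    unfolding is_word_iff
  proof (intro conjI ballI)
    fix x assume x: "x \<in> set W"
    then have "snd x \<noteq> m" using assms(2) by auto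
    then show "1 \<le> fst x" "fst x < snd x" "snd x \<le> m - 1" using W x by (auto simp: is_word_iff)
  qed (use m in simp)
  have cut: "cut_strand 1 r W = map (relabel (next_strand m)) W"
  proof (rule nth_equalityI)
    fix q assume "q < length (cut_strand 1 r W)"
    then have q: "q < length W" by simp
    have "(if q < r then above_cut 1 else below_cut 1) a = next_strand m a" if a: "a \<in> ends (W ! q)" for a
    proof -
      have "a \<in> strands W" using a q mem_strands by blast
      then have "a \<noteq> m" "1 \<le> a" using assms(2) strands_subset[OF W] by auto
      moreover have "q < r \<longrightarrow> a \<noteq> 1" using r(3) a by metis
      ultimately show ?thesis by (auto simp: above_cut_def below_cut_def next_strand_def)
    qed
    then have "relabel (if q < r then above_cut 1 else below_cut 1) (W ! q) = relabel (next_strand m) (W ! q)"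
      by (rule relabel_cong)
    then show "cut_strand 1 r W ! q = map (relabel (next_strand m)) W ! q"
      using q by (simp only: nth_cut nth_map)
  qed simp
  have "(m - 1, W) \<simeq> (m, cut_strand 1 r W)" using meq_cut[OF W' r(1,2)] m by simp
  also have "\<dots> \<simeq> (m, W)" using meq_sym[OF rotate_strands[OF W]] cut by simp
  finally show "(m, W) \<simeq> (m - 1, W)" by (rule meq_sym)
  have "[1..<Suc m] = [1..<Suc (m - 1)] @ [m]" using m by simp
  moreover have "strand_labels W m = []" using assms(2) strand_labels_empty by blast
  ultimately show "label_seq (m - 1, W) = label_seq (m, W)"
    by (simp add: label_seq_def del: upt_Suc)
qed

text \<open>Induction on the number of strands. If some strand is empty, either an occupied strand
  directly follows an empty one, or the occupied strands form an initial segment and the last strand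
  is empty.\<close>

lemma remove_empty_strands:
  assumes "is_word m W" "W \<noteq> []"
  shows "\<exists>m' W'. is_word m' W' \<and> {1..m'} \<subseteq> strands W' \<and> (m, W) \<simeq> (m', W')
    \<and> label_seq (m', W') = label_seq (m, W)"
  using assms
proof (induction m arbitrary: W rule: less_induct)
  case (less m)
  have m: "1 \<le> m" using less.prems by (simp add: is_word_iff)
  consider "{1..m} \<subseteq> strands W" | f where "2 \<le> f" "f \<in> strands W" "f - 1 \<notin> strands W"
    | "m \<notin> strands W" "1 \<in> strands W"
  proof -
    \<comment> \<open>\<open>H\<close> says that there is no gap before an occupied strand, so the
      occupied strands are closed downwards.\<close>
    have "{1..m} \<subseteq> strands W \<or> m \<notin> strands W \<and> 1 \<in> strands W"
      if H: "\<And>f. \<lbrakk>2 \<le> f; f \<in> strands W\<rbrakk> \<Longrightarrow> f - 1 \<in> strands W"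
    proof -
      have down: "g \<in> strands W" if "g \<le> f" "1 \<le> g" "f \<in> strands W" for f g
        using that
      proof (induction rule: inc_induct)
        case (step n)
        then show ?case using H[of "Suc n"] by simp
      qed simp
      \<comment> \<open>As \<open>W\<close> is not empty, some strand is occupied, and hence so is
        strand 1.\<close>
      have "ends (hd W) \<subseteq> strands W" using less.prems(2) by (intro UN_upper) simp
      then have a: "fst (hd W) \<in> strands W" by blast
      then have "1 \<le> fst (hd W)" using strands_subset[OF less.prems(1)] by auto
      then have "1 \<in> strands W" using down a by blast
      moreover have "{1..m} \<subseteq> strands W" if "m \<in> strands W"
      proof
        fix g assume "g \<in> {1..m}"
        then show "g \<in> strands W" using down[of g m] that by simp
      qed
      ultimately show ?thesis by blast
    qed
    then show ?thesis using that by blast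
  qed
  then show ?case
  proof cases
    case 1
    then show ?thesis using less.prems by (intro exI[of _ m] exI[of _ W]) simp
  next
    case 2
    obtain W' where W': "is_word (m - 1) W'" "W' \<noteq> []" "(m, W) \<simeq> (m - 1, W')"
      "label_seq (m - 1, W') = label_seq (m, W)"
      using drop_empty_strand[OF less.prems(1) 2] .
    have "m - 1 < m" using m by simp
    from less.IH[OF this W'(1,2)] obtain m1 W1 where "is_word m1 W1 \<and> {1..m1} \<subseteq> strands W1
        \<and> (m - 1, W') \<simeq> (m1, W1) \<and> label_seq (m1, W1) = label_seq (m, W)"
      unfolding W'(4) by (elim exE)
    then show ?thesis using meq_trans[OF W'(3)] by (intro exI[of _ m1] exI[of _ W1]) simp
  next
    case 3
    note W' = drop_last_strand[OF less.prems(1) 3]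
    have "m - 1 < m" using m by simp
    from less.IH[OF this W'(1) less.prems(2)] obtain m1 W1 where "is_word m1 W1 \<and> {1..m1} \<subseteq> strands W1
        \<and> (m - 1, W) \<simeq> (m1, W1) \<and> label_seq (m1, W1) = label_seq (m, W)"
      unfolding W'(3) by (elim exE)
    then show ?thesis using meq_trans[OF W'(2)] by (intro exI[of _ m1] exI[of _ W1]) simp
  qed
qed

section \<open>Cutting until each strand carries a single label\<close>

lemma length_label_seq: "length (label_seq (m, W)) = (\<Sum>k\<in>{1..m}. length (strand_labels W k))"
  unfolding label_seq_def prod.case length_concat map_map o_def
  by (simp only: interv_sum_list_conv_sum_set_nat set_upt atLeastLessThanSuc_atLeastAtMost)

text \<open>Every occupied strand contributes a label. Since a cut does not change the label
  sequence, this bounds the number of cuts that leave no strand empty.\<close>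

lemma strands_le_length_label_seq:
  assumes "{1..m} \<subseteq> strands W" shows "m \<le> length (label_seq (m, W))"
proof -
  have "(\<Sum>k\<in>{1..m}. 1) \<le> length (label_seq (m, W))"
    unfolding length_label_seq
  proof (rule sum_mono)
    fix k assume "k \<in> {1..m}"
    then have "strand_labels W k \<noteq> []" using assms strand_labels_empty by blast
    then show "1 \<le> length (strand_labels W k)" by (simp add: Suc_leI)
  qed
  then show ?thesis by simp
qed

text \<open>A strand with several labels is cut above its second letter, which leaves no empty half.
  The number \<open>N\<close> of labels is fixed, so \<open>N - m\<close> decreases until each
  strand has one label.\<close>

lemma separate_labels:
  assumes "is_word m W" "{1..m} \<subseteq> strands W" "N = length (label_seq (m, W))"
  shows "\<exists>W'. is_word N W' \<and> (m, W) \<simeq> (N, W') \<and> label_seq (N, W') = label_seq (m, W)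
     \<and> (\<forall>k\<in>{1..N}. length (strand_labels W' k) = 1)"
  using assms
proof (induction "N - m" arbitrary: m W rule: less_induct)
  case less
  have ne: "strand_labels W k \<noteq> []" if "k \<in> {1..m}" for k
    using that less.prems(2) strand_labels_empty by blast
  show ?case
  proof (cases "\<forall>k\<in>{1..m}. length (strand_labels W k) = 1")
    case True
    then have "N = m" using less.prems(3) unfolding length_label_seq by simp
    then show ?thesis using True less.prems by (intro exI[of _ W]) simp
  next
    case False
    then obtain k where k: "k \<in> {1..m}" "length (strand_labels W k) \<noteq> 1" by blast
    then have len: "1 < length (strand_labels W k)" using ne[OF k(1)] by (cases "strand_labels W k") auto
    \<comment> \<open>Index 1 is the second label: the first letter stays above the cut, and letter
      \<open>r\<close> itself falls below it.\<close>
    define r where "r = strand_labels W k ! 1"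
    have s: "sorted_wrt (<) (strand_labels W k)" unfolding strand_labels_def
      by (intro sorted_wrt_filter) (rule sorted_wrt_upt)
    have lt: "strand_labels W k ! 0 < r" unfolding r_def
      using sorted_wrt_nth_less[OF s, of 0 1] len by simp
    have r_in: "r \<in> set (strand_labels W k)" unfolding r_def using len by simp
    have r: "r < length W" "k \<in> ends (W ! r)" using r_in set_strand_labels by blast+
    let ?W = "cut_strand k r W"
    have sub: "{1..m + 1} \<subseteq> strands ?W"
    proof
      fix a assume a: "a \<in> {1..m + 1}"
      have "strand_labels ?W a \<noteq> []"
      proof -
        consider "a < k" | "a = k" | "a = k + 1" | "a > k + 1" by linarith
        then show ?thesis
        proof cases
          case 1
          then show ?thesis using a k ne[of a] by (simp add: strand_labels_cut)
        next
          case 2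
          have "strand_labels W k ! 0 \<in> set (strand_labels W k)" using len by (intro nth_mem) linarith
          then show ?thesis using 2 lt by (auto simp: strand_labels_cut filter_empty_conv)
        next
          case 3
          then show ?thesis using r_in by (auto simp: strand_labels_cut filter_empty_conv)
        next
          case 4
          then have "a - 1 \<in> {1..m}" using a by auto
          then show ?thesis using 4 ne[of "a - 1"] by (simp add: strand_labels_cut)
        qed
      qed
      then show "a \<in> strands ?W" using strand_labels_empty by blast
    qed
    have ls: "label_seq (m + 1, ?W) = label_seq (m, W)" using label_seq_cut k by simp
    have "m + 1 \<le> N" using strands_le_length_label_seq[OF sub] less.prems(3) ls by simp
    then have "N - (m + 1) < N - m" by simp
    from less.hyps[OF this is_word_cut[OF less.prems(1)] sub] less.prems(3) ls
    obtain W' where "is_word N W'" "(m + 1, ?W) \<simeq> (N, W')" "label_seq (N, W') = label_seq (m, W)"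
      "\<forall>k\<in>{1..N}. length (strand_labels W' k) = 1" by auto
    then show ?thesis using meq_trans[OF meq_cut[OF less.prems(1) r]] by blast
  qed
qed

text \<open>Every strand carries exactly one endpoint, and \<open>c k\<close> is the position of the
  only letter touching strand \<open>k\<close>; so \<open>c 1, ..., c N\<close> is the label
  sequence.\<close>

definition spread :: "nat \<Rightarrow> (nat \<times> nat) list \<Rightarrow> (nat \<Rightarrow> nat) \<Rightarrow> bool" where
  "spread N W c \<longleftrightarrow> is_word N W \<and>
     (\<forall>k\<in>{1..N}. c k < length W \<and> (\<forall>r<length W. k \<in> ends (W ! r) \<longleftrightarrow> c k = r))"

text \<open>Empty strands go first, since the separation of labels starts from a word with all
  strands occupied. Neither stage alters the label sequence, which \<open>c\<close> therefore
  reproduces; strands count from 1, list positions from 0.\<close>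

lemma meq_spread:
  assumes "is_word m W" "W \<noteq> []" "s = label_seq (m, W)"
  shows "\<exists>W' c. spread (length s) W' c \<and> (m, W) \<simeq> (length s, W')
    \<and> (\<forall>p<length s. c (p + 1) = s ! p)"
proof -
  obtain m1 W1 where W1: "is_word m1 W1" "{1..m1} \<subseteq> strands W1" "(m, W) \<simeq> (m1, W1)"
    "label_seq (m1, W1) = s"
    using remove_empty_strands[OF assms(1,2)] assms(3) by blast
  let ?N = "length s"
  obtain W2 where W2: "is_word ?N W2" "(m1, W1) \<simeq> (?N, W2)" "label_seq (?N, W2) = s"
    "\<forall>k\<in>{1..?N}. length (strand_labels W2 k) = 1"
    using separate_labels[OF W1(1,2) refl] W1(4) by auto
  define c where "c k = hd (strand_labels W2 k)" for k
  have c: "strand_labels W2 k = [c k]" if "k \<in> {1..?N}" for k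
    using W2(4) that unfolding c_def by (metis One_nat_def length_0_conv length_Suc_conv list.sel(1))
  have "map (strand_labels W2) [1..<Suc ?N] = map (\<lambda>k. [c k]) [1..<Suc ?N]"
    by (rule map_cong) (auto simp only: set_upt atLeastLessThan_iff less_Suc_eq_le atLeastAtMost_iff intro: c)
  then have "s = concat (map (\<lambda>k. [c k]) [1..<Suc ?N])"
    using W2(3) unfolding label_seq_def prod.case by metis
  then have s: "s = map c [1..<Suc ?N]" by (simp only: concat_map_singleton)
  have 1: "c (p + 1) = s ! p" if "p < ?N" for p
    using that by (subst s) (simp del: upt_Suc)
  have "spread ?N W2 c" unfolding spread_def
  proof (intro conjI ballI allI impI)
    fix k assume k: "k \<in> {1..?N}"
    have "c k \<in> set (strand_labels W2 k)" using c[OF k] by simp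
    then show "c k < length W2" using set_strand_labels by blast
    fix r assume "r < length W2"
    then show "k \<in> ends (W2 ! r) \<longleftrightarrow> c k = r"
      using set_strand_labels[of r W2 k] c[OF k] by auto
  qed (rule W2)
  then show ?thesis using 1 meq_trans[OF W1(3) W2(2)] by blast
qed

section \<open>Rearranging spread words\<close>

lemma swap_adjacent:
  assumes "is_word p (U @ [x, y] @ V)" "ends x \<inter> ends y = {}"
  shows "(p, U @ [x, y] @ V) \<simeq> (p, U @ [y, x] @ V)"
proof -
  obtain i j k l where xy: "x = (i, j)" "y = (k, l)" by (cases x, cases y)
  have "distinct [i, j, k, l]" using assms xy by (auto simp: is_word_iff)
  then show ?thesis using meq_move[OF commutativity] assms(1) xy by blast
qed

lemma move_to_front:
  assumes "is_word p (U @ A @ x # B)" "\<And>y. y \<in> set A \<Longrightarrow> ends y \<inter> ends x = {}"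
  shows "(p, U @ A @ x # B) \<simeq> (p, U @ x # A @ B)"
  using assms
proof (induction A arbitrary: B rule: rev_induct)
  case (snoc a A)
  have "(p, (U @ A) @ [a, x] @ B) \<simeq> (p, (U @ A) @ [x, a] @ B)"
    using snoc.prems(1) snoc.prems(2)[of a] by (intro swap_adjacent) (simp_all del: ends_relabel)
  also have "\<dots> \<simeq> (p, U @ x # A @ a # B)"
    using snoc.IH[of "a # B"] snoc.prems by (auto simp: is_word_iff)
  finally show ?case by simp
qed simp

text \<open>Selection sort by commutation: the next letter of \<open>ys\<close> is brought to the
  front of \<open>xs\<close> and joins the part \<open>P\<close> already in place.\<close>

lemma meq_permute:
  assumes "is_word p (P @ xs)" "set xs = set ys" "distinct xs" "distinct ys"
    "\<And>x y. \<lbrakk>x \<in> set xs; y \<in> set xs; x \<noteq> y\<rbrakk> \<Longrightarrow> ends x \<inter> ends y = {}"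
  shows "(p, P @ xs) \<simeq> (p, P @ ys)"
  using assms
proof (induction ys arbitrary: xs P)
  case (Cons y ys)
  have "y \<in> set xs" using Cons.prems(2) by simp
  then obtain A B where xs: "xs = A @ y # B" by (meson split_list)
  have "(p, P @ A @ y # B) \<simeq> (p, P @ y # A @ B)"
  proof (rule move_to_front)
    show "is_word p (P @ A @ y # B)" using Cons.prems(1) xs by simp
    show "ends z \<inter> ends y = {}" if "z \<in> set A" for z
      using Cons.prems(3) that xs by (intro Cons.prems(5)) auto
  qed
  also have "(p, (P @ [y]) @ (A @ B)) \<simeq> (p, (P @ [y]) @ ys)"
  proof (rule Cons.IH)
    show "is_word p ((P @ [y]) @ A @ B)" using Cons.prems(1) xs by (auto simp: is_word_iff)
    show "set (A @ B) = set ys" using Cons.prems(2-4) xs by auto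
    show "ends u \<inter> ends v = {}" if "u \<in> set (A @ B)" "v \<in> set (A @ B)" "u \<noteq> v" for u v
      using that xs by (intro Cons.prems(5)) auto
  qed (use Cons.prems(3,4) xs in auto)
  then have "(p, P @ y # A @ B) \<simeq> (p, P @ y # ys)" by simp
  finally show ?case using xs by simp
qed simp

section \<open>Spread words and their base points\<close>

lemma spread_ends:
  assumes "spread N W c" "r < length W" "k \<in> ends (W ! r)" shows "k \<in> {1..N}" "c k = r"
proof -
  have "k \<in> strands W" using assms mem_strands by blast
  then show k: "k \<in> {1..N}" using assms(1) strands_subset unfolding spread_def by blast
  show "c k = r" using assms k unfolding spread_def by blast
qed

text \<open>The set of letters depends only on which strands \<open>c\<close> identifies; the order
  of the letters has dropped out.\<close>

lemma spread_mem:
  assumes "spread N W c"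
  shows "(a, b) \<in> set W \<longleftrightarrow> 1 \<le> a \<and> a < b \<and> b \<le> N \<and> c a = c b"
proof
  assume "(a, b) \<in> set W"
  then obtain r where r: "r < length W" "W ! r = (a, b)" by (meson in_set_conv_nth)
  have "a < b" using assms r unfolding spread_def is_word_iff by (metis fst_conv nth_mem snd_conv)
  then show "1 \<le> a \<and> a < b \<and> b \<le> N \<and> c a = c b"
    using spread_ends[OF assms r(1), of a] spread_ends[OF assms r(1), of b] r(2) by simp
next
  assume ab: "1 \<le> a \<and> a < b \<and> b \<le> N \<and> c a = c b"
  then have k: "a \<in> {1..N}" "b \<in> {1..N}" by auto
  let ?r = "c a"
  have r: "?r < length W" "a \<in> ends (W ! ?r)" "b \<in> ends (W ! ?r)"
    using assms k ab unfolding spread_def by metis+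
  have "fst (W ! ?r) < snd (W ! ?r)" using assms r(1) unfolding spread_def is_word_iff by simp
  then have "W ! ?r = (a, b)" using r(2,3) ab by (cases "W ! ?r") auto
  then show "(a, b) \<in> set W" using r(1) by (metis nth_mem)
qed

text \<open>Both words have the same letters, each occurring once. Since each strand has one
  endpoint, different letters share no strand and so commute.\<close>

lemma meq_spread_words:
  assumes V: "spread N V c" and W: "spread N W c'"
    and eq: "\<And>a b. \<lbrakk>a \<in> {1..N}; b \<in> {1..N}\<rbrakk> \<Longrightarrow> c a = c b \<longleftrightarrow> c' a = c' b"
  shows "(N, V) \<simeq> (N, W)"
proof -
  have dist: "distinct X" if X: "spread N X d" for X d
    unfolding distinct_conv_nth
  proof (intro allI impI)
    fix q r assume qr: "q < length X" "r < length X" "q \<noteq> r"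
    show "X ! q \<noteq> X ! r"
    proof
      assume e: "X ! q = X ! r"
      have "d (fst (X ! q)) = q" using spread_ends(2)[OF X qr(1)] by simp
      moreover have "d (fst (X ! r)) = r" using spread_ends(2)[OF X qr(2)] by simp
      ultimately show False using e qr(3) by simp
    qed
  qed
  have "set V = set W"
    using eq by (auto simp: spread_mem[OF V] spread_mem[OF W])
  moreover have "ends x \<inter> ends y = {}" if xy: "x \<in> set V" "y \<in> set V" "x \<noteq> y" for x y
  proof -
    obtain q r where q: "q < length V" "x = V ! q" and r: "r < length V" "y = V ! r"
      using xy(1,2) by (metis in_set_conv_nth)
    have "\<not> (k \<in> ends x \<and> k \<in> ends y)" for k
      using spread_ends(2)[OF V q(1), of k] spread_ends(2)[OF V r(1), of k] q r xy(3) by metis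
    then show ?thesis by blast
  qed
  moreover have "is_word N ([] @ V)" using V by (simp add: spread_def)
  ultimately show ?thesis using meq_permute[of N "[]" V W] dist[OF V] dist[OF W] by simp
qed

text \<open>One rotation of the strands moves the base point of the label sequence by one place;
  strand 1 inherits the label of strand \<open>N\<close>.\<close>

lemma spread_next:
  assumes W: "spread N W c"
  shows "spread N (map (relabel (next_strand N)) W) (\<lambda>k. if k = 1 then c N else c (k - 1))"
    (is "spread N ?W ?c")
  unfolding spread_def
proof (intro conjI ballI allI impI)
  have w: "is_word N W" using W by (simp add: spread_def)
  then show "is_word N ?W" by (rule is_word_next)
  fix k assume k: "k \<in> {1..N}"
  define k' where "k' = (if k = 1 then N else k - 1)"
  have k': "k' \<in> {1..N}" "?c k = c k'" using k by (auto simp: k'_def)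
  show "?c k < length ?W" using W k' unfolding spread_def by simp
  fix r assume "r < length ?W"
  then have r: "r < length W" by simp
  have "k \<in> ends (?W ! r) \<longleftrightarrow> k' \<in> ends (W ! r)"
  proof -
    have "k = next_strand N a \<longleftrightarrow> a = k'" if "a \<in> ends (W ! r)" for a
      using spread_ends(1)[OF W r that] k by (auto simp: k'_def next_strand_def)
    then have "k \<in> next_strand N ` ends (W ! r) \<longleftrightarrow> k' \<in> ends (W ! r)" by blast
    then show ?thesis using r by (simp only: nth_map ends_relabel)
  qed
  then show "k \<in> ends (?W ! r) \<longleftrightarrow> ?c k = r" using W k' r unfolding spread_def by simp
qed

lemma spread_rotate:
  assumes "spread N W c"
  shows "\<exists>W' c'. spread N W' c' \<and> (N, W) \<simeq> (N, W') \<and> (\<forall>p<N. c' ((p + d) mod N + 1) = c (p + 1))"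
proof (induction d)
  case 0
  show ?case using assms by (intro exI[of _ W] exI[of _ c]) simp
next
  case (Suc d)
  then obtain W' c' where W': "spread N W' c'" "(N, W) \<simeq> (N, W')"
    "\<forall>p<N. c' ((p + d) mod N + 1) = c (p + 1)" by blast
  let ?c = "\<lambda>k. if k = 1 then c' N else c' (k - 1)"
  have "(N, W) \<simeq> (N, map (relabel (next_strand N)) W')"
    using meq_trans[OF W'(2) rotate_strands] W'(1) by (simp add: spread_def)
  moreover have "?c ((p + Suc d) mod N + 1) = c (p + 1)" if p: "p < N" for p
  proof -
    have "c' ((p + d) mod N + 1) = c (p + 1)" using W'(3) p by blast
    \<comment> \<open>\<open>mod_Suc\<close> separates the wrap-around, where position
      \<open>N - 1\<close> goes to position 0, that is, strand \<open>N\<close> to strand 1.\<close>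
    then show ?thesis by (auto simp: mod_Suc)
  qed
  ultimately show ?case using spread_next[OF W'(1)] by blast
qed

text \<open>Both words are brought to spread form. Then \<open>d\<close> rotations of the first
  align its base point with that of the second, and equal chord patterns leave only
  commutations.\<close>

lemma meq_if_label_seqs_match:
  assumes V: "is_word l V" "V \<noteq> []" and W: "is_word m W" "W \<noteq> []"
    and s: "s = label_seq (l, V)" "N = length s" and t: "t = label_seq (m, W)" "N = length t"
    and match: "\<And>p q. \<lbrakk>p < N; q < N\<rbrakk> \<Longrightarrow> s ! p = s ! q \<longleftrightarrow> t ! ((p + d) mod N) = t ! ((q + d) mod N)"
  shows "(l, V) \<simeq> (m, W)"
proof -
  obtain V1 c1 where V1: "spread N V1 c1" "(l, V) \<simeq> (N, V1)" "\<forall>p<N. c1 (p + 1) = s ! p"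
    using meq_spread[OF V s(1)] unfolding s(2) by blast
  obtain W1 c' where W1: "spread N W1 c'" "(m, W) \<simeq> (N, W1)" "\<forall>p<N. c' (p + 1) = t ! p"
    using meq_spread[OF W t(1)] unfolding t(2) by blast
  obtain V2 c2 where V2: "spread N V2 c2" "(N, V1) \<simeq> (N, V2)"
    "\<forall>p<N. c2 ((p + d) mod N + 1) = c1 (p + 1)"
    using spread_rotate[OF V1(1), of d] by blast
  have ex: "\<exists>p<N. a = (p + d) mod N + 1 \<and> c2 a = s ! p \<and> c' a = t ! ((p + d) mod N)"
    if a: "a \<in> {1..N}" for a
  proof -
    \<comment> \<open>\<open>p\<close> is \<open>a - 1 - d\<close> modulo \<open>N\<close>; adding
      \<open>N - d mod N\<close> avoids truncated subtraction.\<close>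
    define p where "p = (a - 1 + (N - d mod N)) mod N"
    have N: "0 < N" using a by auto
    have "(p + d) mod N = (a - 1 + (N - d mod N) + d mod N) mod N"
      unfolding p_def by (simp add: mod_add_left_eq mod_add_right_eq)
    also have "a - 1 + (N - d mod N) + d mod N = a - 1 + N"
      using mod_less_divisor[OF N, of d] by simp
    finally have "(p + d) mod N = (a - 1) mod N" by simp
    also have "\<dots> = a - 1" using a by (intro mod_less) auto
    finally have e: "a = (p + d) mod N + 1" using a by simp
    have p: "p < N" unfolding p_def using N by simp
    have "c2 a = s ! p" using V2(3) V1(3) p e by simp
    moreover have "c' a = t ! ((p + d) mod N)" using W1(3) e N by simp
    ultimately show ?thesis using p e by blast
  qed
  have "(N, V2) \<simeq> (N, W1)"
  proof (rule meq_spread_words[OF V2(1) W1(1)])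
    fix a b assume "a \<in> {1..N}" "b \<in> {1..N}"
    then obtain p q where p: "p < N" "c2 a = s ! p" "c' a = t ! ((p + d) mod N)"
      and q: "q < N" "c2 b = s ! q" "c' b = t ! ((q + d) mod N)"
      using ex by blast
    show "c2 a = c2 b \<longleftrightarrow> c' a = c' b"
      unfolding p(2,3) q(2,3) by (rule match[OF p(1) q(1)])
  qed
  from meq_trans[OF meq_trans[OF V1(2) V2(2)] meq_trans[OF this meq_sym[OF W1(2)]]] show ?thesis .
qed

section \<open>From diagrams to label sequences\<close>

definition root_of_unity :: "nat \<Rightarrow> nat \<Rightarrow> complex" where
  "root_of_unity N p = cis (2 * pi * real p / real N)"

lemma inj_on_root_of_unity: "inj_on (root_of_unity N) {..<N}"
proof (cases "N = 0")
  case False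
  then show ?thesis
    using Complex.bij_betw_roots_unity[of N] by (simp add: bij_betw_def inj_on_def root_of_unity_def)
qed simp

lemma closure_config_eq:
  "closure_config (m, W) = (\<lambda>r. root_of_unity (length (label_seq (m, W))) `
     {p. p < length (label_seq (m, W)) \<and> label_seq (m, W) ! p = r}) ` {..<length W}"
  by (auto simp: closure_config_def Let_def root_of_unity_def image_def)

lemma label_less:
  assumes "p < length (label_seq (m, W))" shows "label_seq (m, W) ! p < length W"
proof -
  have "label_seq (m, W) ! p \<in> set (label_seq (m, W))" using assms by simp
  then show ?thesis by (auto simp: label_seq_def strand_labels_def simp del: upt_Suc)
qed

lemma Union_closure_config:
  "\<Union> (closure_config (m, W)) = root_of_unity (length (label_seq (m, W))) ` {..<length (label_seq (m, W))}"
  unfolding closure_config_eq using label_less[of _ m W] by blast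

text \<open>A configuration forgets the names of its chords. Because the roots are distinct, it
  still shows whether two positions carry the same label.\<close>

lemma same_chord_iff:
  assumes "s = label_seq (m, W)" "N = length s" "p < N" "q < N"
  shows "(\<exists>c\<in>closure_config (m, W). root_of_unity N p \<in> c \<and> root_of_unity N q \<in> c) \<longleftrightarrow> s ! p = s ! q"
proof -
  have mem: "root_of_unity N p' \<in> root_of_unity N ` {p. p < N \<and> s ! p = r} \<longleftrightarrow> s ! p' = r"
    if "p' < N" for p' r
  proof
    assume "root_of_unity N p' \<in> root_of_unity N ` {p. p < N \<and> s ! p = r}"
    then obtain p'' where "p'' < N" "s ! p'' = r" "root_of_unity N p' = root_of_unity N p''" by blast
    then show "s ! p' = r" using inj_onD[OF inj_on_root_of_unity, of N p' p''] that by simp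
  qed (use that in blast)
  have C: "closure_config (m, W) = (\<lambda>r. root_of_unity N ` {p. p < N \<and> s ! p = r}) ` {..<length W}"
    using closure_config_eq assms(1,2) by simp
  show ?thesis unfolding C using mem[OF assms(3)] mem[OF assms(4)]
      label_less[of p m W] assms by auto
qed

text \<open>The lift \<open>g\<close> of the homeomorphism sends the \<open>N\<close> roots in a period injectively and monotonically
  to \<open>N\<close> roots in a period, so it has no choice but to shift them.\<close>

lemma orient_homeo_roots:
  assumes h: "orient_homeo h" and N: "0 < N"
    and roots: "\<And>p. p < N \<Longrightarrow> h (root_of_unity N p) \<in> root_of_unity N ` {..<N}"
  shows "\<exists>d. \<forall>p<N. h (root_of_unity N p) = root_of_unity N ((p + d) mod N)"
proof -
  obtain g :: "real \<Rightarrow> real" where g: "strict_mono g" "\<And>t. g (t + 2 * pi) = g t + 2 * pi"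
    "\<And>t. h (cis t) = cis (g t)"
    using h unfolding orient_homeo_def by blast
  \<comment> \<open>The angles of the roots, indexed by all integers because \<open>g\<close> acts
    on the universal cover.\<close>
  define x where "x k = 2 * pi * real_of_int k / real N" for k
  have x_mod: "x (a + int N * k) = x a + 2 * pi * real_of_int k" for a k
    using N by (simp add: x_def field_simps)
  have cis_x_mod: "cis (x (a + int N * k)) = cis (x a)" for a k
    unfolding x_mod by (simp add: cis_mult[symmetric])
  have x_less: "x a < x b \<longleftrightarrow> a < b" for a b
    using N by (simp add: x_def divide_less_cancel)
  have root: "root_of_unity N p = cis (x (int p))" for p by (simp add: x_def root_of_unity_def)
  have ex: "\<exists>u. g (x (int p)) = x u" if p: "p < N" for p
  proof -
    obtain q where q: "cis (g (x (int p))) = cis (x (int q))"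
      using roots[OF p] g(3) by (auto simp: root)
    then obtain k :: int where "g (x (int p)) = x (int q) + 2 * pi * k"
      using sin_cos_eq_iff[of "g (x (int p))" "x (int q)"] by (auto simp: complex_eq_iff)
    then show ?thesis using x_mod by metis
  qed
  then obtain u where u: "\<And>p. p < N \<Longrightarrow> g (x (int p)) = x (u p)" by metis
  have u_mono: "u p < u q" if "p < q" "q < N" for p q
  proof -
    have "g (x (int p)) < g (x (int q))"
      using that x_less by (intro strict_monoD[OF g(1)]) simp
    then show ?thesis using u that x_less by simp
  qed
  \<comment> \<open>Periodicity of \<open>g\<close> keeps all images within one turn of the
    first.\<close>
  have u_top: "u p < u 0 + int N" if "p < N" for p
  proof -
    have "x (int p) < x 0 + 2 * pi" using that x_less[of "int p" "0 + int N * 1"] x_mod[of 0 1] by simp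
    then have "g (x (int p)) < g (x 0 + 2 * pi)" by (rule strict_monoD[OF g(1)])
    then have "g (x (int p)) < g (x (int 0)) + 2 * pi" by (simp add: g(2))
    also have "\<dots> = x (u 0 + int N * 1)" using u[OF N] x_mod[of "u 0" 1] by simp
    finally show ?thesis using u[OF that] x_less by simp
  qed
  have lower: "u 0 + int p \<le> u p" if "p < N" for p
    using that
  proof (induction p)
    case (Suc p)
    then show ?case using u_mono[of p "Suc p"] by simp
  qed simp
  \<comment> \<open>Here \<open>k\<close> counts steps towards the end of the period;
    \<open>k = N - 1 - p\<close> gives the bound that matches \<open>lower\<close>.\<close>
  have upper: "u p + int k < u 0 + int N" if "p + k < N" for p k
    using that
  proof (induction k arbitrary: p)
    case 0
    then show ?case using u_top by simp
  next
    case (Suc k)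
    have "Suc p + k < N" using Suc.prems by simp
    from Suc.IH[OF this] have "u (Suc p) + int k < u 0 + int N" .
    moreover have "u p < u (Suc p)" using u_mono Suc.prems by simp
    ultimately show ?case by simp
  qed
  have u_eq: "u p = u 0 + int p" if "p < N" for p
    using lower[OF that] upper[of p "N - 1 - p"] that by simp
  \<comment> \<open>\<open>u 0\<close> may be negative, so it is reduced modulo \<open>N\<close>
    before passing to \<open>nat\<close>.\<close>
  define d where "d = nat (u 0 mod int N)"
  have "h (root_of_unity N p) = root_of_unity N ((p + d) mod N)" if p: "p < N" for p
  proof -
    have "int ((p + d) mod N) = (u 0 + int p) mod int N"
      using N by (simp add: d_def zmod_int mod_add_right_eq add.commute)
    then have "int ((p + d) mod N) + int N * ((u 0 + int p) div int N) = u 0 + int p"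
      by simp
    then have "cis (x (u 0 + int p)) = cis (x (int ((p + d) mod N)))"
      using cis_x_mod by metis
    then show ?thesis using g(3) u[OF p] u_eq[OF p] by (simp add: root)
  qed
  then show ?thesis by blast
qed

text \<open>The homeomorphism is injective on the circle, so both closures have equally many marked
  points. It shifts the roots and carries chords to chords, hence preserves the relation of sharing
  a label.\<close>

lemma closure_match:
  assumes V: "is_word l V" "V \<noteq> []" and W: "is_word m W"
    and eq: "word_closure (l, V) = word_closure (m, W)"
    and s: "s = label_seq (l, V)" "N = length s" and t: "t = label_seq (m, W)"
  shows "length t = N"
    "\<exists>d. \<forall>p<N. \<forall>q<N. s ! p = s ! q \<longleftrightarrow> t ! ((p + d) mod N) = t ! ((q + d) mod N)"
proof -
  let ?C = "closure_config (l, V)" and ?C' = "closure_config (m, W)"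
  have C: "?C \<in> chord_configs (length V)" "?C' \<in> chord_configs (length W)"
    using closure_config_in V W by blast+
  have "?C' \<in> config_rel `` {?C'}" using equiv_class_self[OF equiv_config_rel] C(2) by blast
  then have "(?C, ?C') \<in> config_rel" using eq unfolding word_closure_def by blast
  then obtain h where h: "orient_homeo h" and C': "?C' = (\<lambda>c. h ` c) ` ?C"
    unfolding config_rel_def by blast
  have inj: "inj_on h circle" using h unfolding orient_homeo_def homeomorphism_def
    by (metis inj_on_inverseI)
  have circ: "c \<subseteq> circle" if "c \<in> ?C" for c using C(1) that unfolding chord_configs_def by blast
  have un: "\<Union> ?C' = h ` \<Union> ?C" unfolding C' by blast
  have unC: "\<Union> ?C = root_of_unity N ` {..<N}" using Union_closure_config s by simp
  have unC': "\<Union> ?C' = root_of_unity (length t) ` {..<length t}" using Union_closure_config t by simp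
  have "card (\<Union> ?C) = N" unfolding unC by (simp add: card_image inj_on_root_of_unity)
  moreover have "card (\<Union> ?C') = length t" unfolding unC' by (simp add: card_image inj_on_root_of_unity)
  moreover have "card (h ` \<Union> ?C) = card (\<Union> ?C)"
    by (rule card_image, rule inj_on_subset[OF inj]) (use circ in blast)
  ultimately show len: "length t = N" by (simp only: un)
  \<comment> \<open>A letter of \<open>V\<close> gives a chord and hence a marked point, so that
    \<open>N\<close> is positive.\<close>
  have "?C \<noteq> {}" using V(2) by (simp add: closure_config_eq lessThan_empty_iff)
  moreover have "c \<noteq> {}" if "c \<in> ?C" for c using that C(1) unfolding chord_configs_def by force
  ultimately have "\<Union> ?C \<noteq> {}" by blast
  then have N: "0 < N" unfolding unC by auto
  have "h (root_of_unity N p) \<in> root_of_unity N ` {..<N}" if "p < N" for p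
    using un unfolding unC unC' len using that by blast
  from orient_homeo_roots[OF h N this] obtain d where
    d: "\<And>p. p < N \<Longrightarrow> h (root_of_unity N p) = root_of_unity N ((p + d) mod N)" by blast
  have "s ! p = s ! q \<longleftrightarrow> t ! ((p + d) mod N) = t ! ((q + d) mod N)" if p: "p < N" and q: "q < N" for p q
  proof -
    have "s ! p = s ! q \<longleftrightarrow> (\<exists>c\<in>?C. root_of_unity N p \<in> c \<and> root_of_unity N q \<in> c)"
      using same_chord_iff[OF s p q] by simp
    also have "\<dots> \<longleftrightarrow> (\<exists>c\<in>?C'. h (root_of_unity N p) \<in> c \<and> h (root_of_unity N q) \<in> c)"
    proof -
      have "h (root_of_unity N p) \<in> h ` c \<longleftrightarrow> root_of_unity N p \<in> c" if "c \<in> ?C" for c p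
        by (rule inj_on_image_mem_iff[OF inj _ circ[OF that]]) (simp add: root_of_unity_def)
      then show ?thesis unfolding C' by simp
    qed
    also have "\<dots> \<longleftrightarrow> t ! ((p + d) mod N) = t ! ((q + d) mod N)"
      unfolding d[OF p] d[OF q] using same_chord_iff[OF t len[symmetric]] N by simp
    finally show ?thesis .
  qed
  then show "\<exists>d. \<forall>p<N. \<forall>q<N. s ! p = s ! q \<longleftrightarrow> t ! ((p + d) mod N) = t ! ((q + d) mod N)" by blast
qed

text \<open>The empty word closes to a configuration without chords, whose image under a
  homeomorphism again has none.\<close>

lemma braiding_nonempty:
  assumes "n \<ge> 1" "D \<in> chord_diagrams n" "braiding (l, V) D" shows "V \<noteq> []"
proof
  assume "V = []"
  obtain C where C: "C \<in> chord_configs n" "D = config_rel `` {C}"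
    using assms(2) unfolding chord_diagrams_def by blast
  have "C \<in> config_rel `` {C}" using equiv_class_self[OF equiv_config_rel] C(1) by blast
  then have "(closure_config (l, V), C) \<in> config_rel"
    using assms(3) C(2) unfolding braiding_def word_closure_def by blast
  then obtain h where "C = (\<lambda>c. h ` c) ` closure_config (l, V)"
    unfolding config_rel_def by blast
  then have "C = {}" using \<open>V = []\<close> by (simp add: closure_config_eq)
  then show False using C(1) assms(1) unfolding chord_configs_def by simp
qed

theorem theorem2p3:
  fixes n l m :: nat
    and D :: "complex set set set"
    and V W :: "(nat \<times> nat) list"
  assumes "n \<ge> 1"
    and "D \<in> chord_diagrams n"
    and "braiding (l, V) D"
    and "braiding (m, W) D"
  shows "equivclp move (l, V) (m, W)"
proof -
  have ne: "V \<noteq> []" "W \<noteq> []" using braiding_nonempty assms by blast+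
  have words: "is_word l V" "is_word m W" and eq: "word_closure (l, V) = word_closure (m, W)"
    using assms(3,4) unfolding braiding_def by simp_all
  let ?s = "label_seq (l, V)" and ?t = "label_seq (m, W)"
  note match = closure_match[OF words(1) ne(1) words(2) eq refl refl refl]
  obtain d where d: "\<forall>p<length ?s. \<forall>q<length ?s.
      ?s ! p = ?s ! q \<longleftrightarrow> ?t ! ((p + d) mod length ?s) = ?t ! ((q + d) mod length ?s)"
    using match(2) by (elim exE)
  show ?thesis
    by (rule meq_if_label_seqs_match[OF words(1) ne(1) words(2) ne(2) refl refl refl match(1)[symmetric] d[rule_format]])
qed

end
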